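(* Let $X$ and $Y$ be random variables with distributions $F$ and $G$ respectively, where $F$ has as support the whole real axis and $G(0-)=0$, $G(0)<1$. Let $H$ be the distribution of $XY$. Suppose that (A) for any $c>0$, $\overline{G}(cx)=o[\overline{H}(x)]$ as $x\to\infty$; (B) there exists a function $h:[0,\infty)\to(0,\infty)$ such that $\mathbf{P}[X>x\mid Y=y]\sim h(y)\,\mathbf{P}[X>x]$ as $x\to\infty$, uniformly for $y\in S_Y$. If $F\in\mathcal{P_D}$, then $H\in\mathcal{P_D}$.
   Context: For a distribution $F$ write $\overline{F}:=1-F$; throughout $\overline{F}(x)>0$ for all $x\ge 0$. $H(x):=\mathbf{P}[XY\le x]$. $S_Y$ is the support of $Y$. Uniformity in (B) means $\lim_{x\to\infty}\sup_{y\in S_Y}\left|\frac{\mathbf{P}[X>x\mid Y=y]}{h(y)\mathbf{P}[X>x]}-1\right|=0$. $F\in\mathcal{P_D}$ (positively decreasing) if for all (equivalently, for some) $v>1$, $\limsup_{x\to\infty}\overline{F}(vx)/\overline{F}(x)<1$. *)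

theory Defs
  imports "HOL-Probability.Probability" "HOL-Library.Landau_Symbols"
begin

definition tail :: "(real \<Rightarrow> real) \<Rightarrow> real \<Rightarrow> real" where
  "tail F x = 1 - F x"

text \<open>Positively decreasing distribution functions.  The convention that tails never vanish on
  the nonnegative half-line is part of the class, so the quotient never divides by zero.
  The limit superior is taken in \<^typ>\<open>ereal\<close>.\<close>

definition PD :: "(real \<Rightarrow> real) set" where
  "PD = {F. (\<exists>N. real_distribution N \<and> F = cdf N) \<and> (\<forall>x\<ge>0. tail F x > 0) \<and>
     (\<forall>v>1. Limsup at_top (\<lambda>x. ereal (tail F (v * x) / tail F x)) < 1)}"

definition measure_support :: "real measure \<Rightarrow> real set" where
  "measure_support N = {y. \<forall>U. open U \<longrightarrow> y \<in> U \<longrightarrow> emeasure N U > 0}"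

text \<open>\<open>K\<close> is a version of the conditional law of \<open>X\<close> given \<open>Y\<close>: the measure \<open>K y\<close> plays the role
  of \<open>P[X \<in> \<cdot> | Y = y]\<close>.  Measurability into \<^const>\<open>prob_algebra\<close> says that \<open>K\<close> is a Markov
  kernel.\<close>

definition regular_cond_distribution ::
    "'a measure \<Rightarrow> ('a \<Rightarrow> real) \<Rightarrow> ('a \<Rightarrow> real) \<Rightarrow> (real \<Rightarrow> real measure) \<Rightarrow> bool" where
  "regular_cond_distribution M X Y K \<longleftrightarrow>
     K \<in> measurable borel (prob_algebra borel) \<and>
     (\<forall>A\<in>sets borel. \<forall>B\<in>sets borel.
        \<P>(\<omega> in M. X \<omega> \<in> A \<and> Y \<omega> \<in> B) = (LINT y:B|distr M borel Y. measure (K y) A))"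

end

theory Submission
  imports Defs
begin

text \<open>
  Conditioning on \<open>Y\<close> turns the tail of the product into a mixture of scaled conditional tails: for
  \<open>x \<ge> 0\<close>, the probability \<open>P[X Y > x]\<close> is the integral of \<open>P[X > x / y | Y = y]\<close> over \<open>y > 0\<close> with
  respect to the law of \<open>Y\<close>.  So it suffices to compare the integrands at \<open>v x\<close> and at \<open>x\<close>.  By the
  uniform equivalence, every conditional tail inherits the positive decrease of the tail of \<open>X\<close>,
  with a constant that is the same for all \<open>y\<close>: there are \<open>q < 1\<close> and \<open>T > 0\<close> with

    \<open>P[X > v t | Y = y] \<le> q P[X > t | Y = y]\<close> for \<open>t \<ge> T\<close> and \<open>y\<close> in the support of \<open>Y\<close>,

  because the weights \<open>h y\<close> cancel in the quotient (lemma \<open>uniform_tail_decrease\<close>).  This applies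
  with \<open>t = x / y\<close> as long as \<open>y \<le> x / T\<close>.  The remaining values of \<open>y\<close> have total mass
  \<open>P[Y > x / T]\<close>, which the assumption on the tail of \<open>Y\<close> makes negligible against \<open>P[X Y > x]\<close>.
  Hence

    \<open>P[X Y > v x] \<le> q P[X Y > x] + P[Y > x / T] = (q + o(1)) P[X Y > x]\<close>.

  The mixture formula is \<open>emeasure_product_gt\<close>.  The pointwise comparison is available on the
  support of \<open>Y\<close> only; it can be integrated because the support carries the whole mass
  (\<open>AE_measure_support\<close>).
\<close>

section \<open>Tails and supports\<close>

lemma tail_cdf:
  assumes "real_distribution N"
  shows "tail (cdf N) x = measure N {x<..}"
proof -
  interpret real_distribution N by fact
  have "{x<..} = space N - {..x}" by auto
  then show ?thesis
    using prob_compl[of "{..x}"] by (simp add: tail_def cdf_def)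
qed

text \<open>The complement of the support is a union of open null sets, and the real line is second
  countable, so countably many of them cover it.\<close>

lemma AE_measure_support:
  assumes "sets N = sets borel"
  shows "AE y in N. y \<in> measure_support N"
proof -
  obtain \<V> where \<V>: "\<V> \<subseteq> {U. open U \<and> emeasure N U = 0}" "countable \<V>"
      "\<Union>\<V> = \<Union>{U. open U \<and> emeasure N U = 0}"
    using Lindelof[of "{U :: real set. open U \<and> emeasure N U = 0}"] by auto
  have "(\<Union>U\<in>\<V>. U) \<in> null_sets N"
    using \<V>(1) assms by (intro null_sets_UN'[OF \<V>(2)]) (auto simp: null_sets_def)
  moreover have "- measure_support N = (\<Union>U\<in>\<V>. U)"
    using \<V>(3) by (auto simp: measure_support_def)
  ultimately show ?thesis
    by (intro AE_I'[of "\<Union>U\<in>\<V>. U"]) auto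
qed

section \<open>The tail of a product as a mixture\<close>

lemma regular_cond_distribution_kernel:
  assumes "regular_cond_distribution M X Y K"
  shows "K \<in> borel \<rightarrow>\<^sub>M prob_algebra borel" "prob_space (K y)" "sets (K y) = sets borel"
proof -
  show K: "K \<in> borel \<rightarrow>\<^sub>M prob_algebra borel"
    using assms by (simp add: regular_cond_distribution_def)
  show "prob_space (K y)" "sets (K y) = sets borel"
    using measurable_space[OF K, of y] by (auto simp: space_prob_algebra)
qed

text \<open>The defining property of a regular conditional distribution speaks of measurable rectangles
  only.  Both sides of the claim are probability measures in \<open>A\<close>: the joint law of \<open>X\<close> and \<open>Y\<close>, and
  the law obtained by drawing \<open>y\<close> from the distribution of \<open>Y\<close> and then \<open>x\<close> from \<open>K y\<close>.  Rectangles
  are stable under intersection and generate the product \<open>\<sigma>\<close>-algebra, so the two laws coincide.\<close>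

lemma regular_cond_distribution_joint_law:
  assumes "prob_space M"
    and [measurable]: "X \<in> borel_measurable M" "Y \<in> borel_measurable M"
    and K: "regular_cond_distribution M X Y K"
    and A: "A \<in> sets (borel \<Otimes>\<^sub>M borel)"
  shows "emeasure M {\<omega> \<in> space M. (X \<omega>, Y \<omega>) \<in> A}
    = (\<integral>\<^sup>+ y. emeasure (K y) {x. (x, y) \<in> A} \<partial>distr M borel Y)"
proof -
  interpret prob_space M by fact
  define \<nu> where "\<nu> = distr M borel Y"
  define P :: "(real \<times> real) measure" where "P = borel \<Otimes>\<^sub>M borel"
  define J where "J = distr M P (\<lambda>\<omega>. (X \<omega>, Y \<omega>))"
  define Q where "Q = \<nu> \<bind> (\<lambda>y. distr (K y) P (\<lambda>x. (x, y)))"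
  have sets_\<nu>[simp]: "sets \<nu> = sets borel" "space \<nu> = UNIV" by (auto simp: \<nu>_def)
  interpret \<nu>: prob_space \<nu> unfolding \<nu>_def by (rule prob_space_distr) simp
  have \<nu>_alg: "\<nu> \<in> space (prob_algebra borel)"
    by (simp add: space_prob_algebra \<nu>.prob_space_axioms)
  note K_meas = regular_cond_distribution_kernel(1)[OF K]
    and K_prob = regular_cond_distribution_kernel(2)[OF K]
    and sets_K = regular_cond_distribution_kernel(3)[OF K]
  have space_K: "space (K y) = UNIV" for y
    using sets_eq_imp_space_eq[OF sets_K] by simp
  have kernel: "(\<lambda>y. distr (K y) P (\<lambda>x. (x, y))) \<in> borel \<rightarrow>\<^sub>M prob_algebra P"
    using K_meas by (intro measurable_distr_prob_space2[of _ _ borel]) (auto simp: P_def)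
  have Q_eq: "emeasure Q C = (\<integral>\<^sup>+ y. emeasure (K y) {x. (x, y) \<in> C} \<partial>\<nu>)"
    if "C \<in> sets P" for C
    unfolding Q_def emeasure_bind_prob_algebra[OF \<nu>_alg kernel that]
  proof (rule nn_integral_cong)
    fix y
    have "(\<lambda>x. (x, y)) \<in> K y \<rightarrow>\<^sub>M P"
      unfolding P_def by (subst measurable_cong_sets[OF sets_K refl]) measurable
    then show "emeasure (distr (K y) P (\<lambda>x. (x, y))) C = emeasure (K y) {x. (x, y) \<in> C}"
      using that by (simp add: emeasure_distr space_K vimage_def)
  qed
  have J_meas: "(\<lambda>\<omega>. (X \<omega>, Y \<omega>)) \<in> M \<rightarrow>\<^sub>M P" by (simp add: P_def)
  have sets_Q: "sets Q = sets P"
    unfolding Q_def using kernel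
    by (intro sets_bind) (auto dest: measurable_space simp: space_prob_algebra)
  let ?E = "{a \<times> b |a b. a \<in> sets (borel :: real measure) \<and> b \<in> sets (borel :: real measure)}"
  have "J = Q"
  proof (rule measure_eqI_generator_eq[where E = ?E and \<Omega> = UNIV and A = "\<lambda>_. UNIV"])
    show "Int_stable ?E" by (rule Int_stable_pair_measure_generator)
    show "sets J = sigma_sets UNIV ?E" "sets Q = sigma_sets UNIV ?E"
      by (auto simp: sets_Q J_def P_def sets_pair_measure)
    show "emeasure J (UNIV :: (real \<times> real) set) \<noteq> \<infinity>" for i :: nat
      unfolding J_def using prob_space_distr[OF J_meas]
      by (simp add: prob_space.finite_measure finite_measure.emeasure_finite)
    have "UNIV \<times> UNIV \<in> ?E" by (intro CollectI exI[of _ UNIV]) simp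
    then show "range (\<lambda>_ :: nat. UNIV) \<subseteq> ?E"
      unfolding UNIV_Times_UNIV by - (rule image_subsetI, assumption)
    fix C assume "C \<in> ?E"
    then obtain a b where C: "C = a \<times> b" and [measurable]: "a \<in> sets borel" "b \<in> sets borel"
      by auto
    have CP: "C \<in> sets P" by (simp add: C P_def)
    have K_a: "(\<lambda>y. measure (K y) a) \<in> borel_measurable borel"
      using K_meas by (intro measurable_compose[OF measurable_prob_algebraD[OF K_meas]]) simp
    have "emeasure J C = emeasure M {\<omega> \<in> space M. X \<omega> \<in> a \<and> Y \<omega> \<in> b}"
      using CP J_meas by (simp add: J_def emeasure_distr C vimage_def Int_def conj_commute)
    also have "\<dots> = ennreal (LINT y:b|\<nu>. measure (K y) a)"
      using K by (simp add: emeasure_eq_measure regular_cond_distribution_def \<nu>_def)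
    also have "\<dots> = (\<integral>\<^sup>+ y. ennreal (indicator b y * measure (K y) a) \<partial>\<nu>)"
      unfolding set_lebesgue_integral_def real_scaleR_def
    proof (rule nn_integral_eq_integral[symmetric])
      have "(\<lambda>y. indicator b y * measure (K y) a) \<in> borel_measurable \<nu>"
        using K_a by (simp add: \<nu>_def)
      then show "integrable \<nu> (\<lambda>y. indicator b y * measure (K y) a)"
        by (rule \<nu>.integrable_const_bound[where B = 1, rotated])
          (auto simp: indicator_def prob_space.prob_le_1[OF K_prob])
    qed auto
    also have "\<dots> = (\<integral>\<^sup>+ y. emeasure (K y) {x. (x, y) \<in> C} \<partial>\<nu>)"
    proof (rule nn_integral_cong)
      fix y
      interpret Ky: prob_space "K y" by (rule K_prob)
      show "ennreal (indicator b y * measure (K y) a) = emeasure (K y) {x. (x, y) \<in> C}"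
        by (cases "y \<in> b") (auto simp: C Ky.emeasure_eq_measure)
    qed
    finally show "emeasure J C = emeasure Q C" by (simp add: Q_eq[OF CP])
  qed auto
  then have "emeasure J A = (\<integral>\<^sup>+ y. emeasure (K y) {x. (x, y) \<in> A} \<partial>\<nu>)"
    using Q_eq A by (simp add: P_def)
  moreover have "emeasure J A = emeasure M {\<omega> \<in> space M. (X \<omega>, Y \<omega>) \<in> A}"
    using A J_meas by (simp add: J_def emeasure_distr P_def vimage_def Int_def conj_commute)
  ultimately show ?thesis by (simp add: \<nu>_def)
qed

lemma emeasure_product_gt:
  assumes "prob_space M" "X \<in> borel_measurable M" "Y \<in> borel_measurable M"
    and "regular_cond_distribution M X Y K"
  shows "emeasure M {\<omega> \<in> space M. x < X \<omega> * Y \<omega>}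
    = (\<integral>\<^sup>+ y. emeasure (K y) {s. x < s * y} \<partial>distr M borel Y)"
proof -
  have "{p :: real \<times> real. x < fst p * snd p} \<in> sets (borel \<Otimes>\<^sub>M borel)"
    unfolding borel_prod by (intro borel_open open_Collect_less continuous_intros)
  from regular_cond_distribution_joint_law[OF assms this] show ?thesis by simp
qed

section \<open>Uniform decrease of the conditional tails\<close>

lemma Limsup_less_1_bound:
  fixes f :: "'a \<Rightarrow> real"
  assumes "Limsup L (\<lambda>x. ereal (f x)) < 1"
  obtains \<rho> where "0 < \<rho>" "\<rho> < 1" "\<forall>\<^sub>F x in L. f x < \<rho>"
proof -
  have "max 0 (Limsup L (\<lambda>x. ereal (f x))) < 1" using assms by simp
  then obtain \<rho> where \<rho>: "max 0 (Limsup L (\<lambda>x. ereal (f x))) < ereal \<rho>" "ereal \<rho> < 1"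
    using ereal_dense2 by blast
  then have "\<forall>\<^sub>F x in L. ereal (f x) < ereal \<rho>" by (intro Limsup_lessD) simp
  then show thesis using \<rho> that[of \<rho>] by simp
qed

lemma uniform_equiv_bounds:
  fixes k :: "'b \<Rightarrow> real \<Rightarrow> real" and p :: "real \<Rightarrow> real"
  assumes unif: "((\<lambda>x. SUP y\<in>S. ereal \<bar>k y x / (h y * p x) - 1\<bar>) \<longlongrightarrow> 0) at_top"
    and h: "\<And>y. y \<in> S \<Longrightarrow> h y > 0"
    and p: "\<And>x. x \<ge> 0 \<Longrightarrow> p x > 0"
    and "\<epsilon> > 0"
  shows "\<forall>\<^sub>F x in at_top. \<forall>y\<in>S. (1 - \<epsilon>) * (h y * p x) \<le> k y x \<and> k y x \<le> (1 + \<epsilon>) * (h y * p x)"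
proof -
  have "\<forall>\<^sub>F x in at_top. (SUP y\<in>S. ereal \<bar>k y x / (h y * p x) - 1\<bar>) < ereal \<epsilon>"
    using order_tendstoD(2)[OF unif, of "ereal \<epsilon>"] \<open>\<epsilon> > 0\<close> by simp
  then show ?thesis
    using eventually_ge_at_top[of 0]
  proof eventually_elim
    case (elim x)
    show ?case
    proof
      fix y assume y: "y \<in> S"
      have "ereal \<bar>k y x / (h y * p x) - 1\<bar> \<le> (SUP y\<in>S. ereal \<bar>k y x / (h y * p x) - 1\<bar>)"
        using y by (rule SUP_upper)
      then have "ereal \<bar>k y x / (h y * p x) - 1\<bar> < ereal \<epsilon>"
        using elim(1) by (rule le_less_trans)
      then have "1 - \<epsilon> \<le> k y x / (h y * p x)" "k y x / (h y * p x) \<le> 1 + \<epsilon>"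
        by simp_all
      moreover have "h y * p x > 0" using h[OF y] p[OF elim(2)] by simp
      ultimately show "(1 - \<epsilon>) * (h y * p x) \<le> k y x \<and> k y x \<le> (1 + \<epsilon>) * (h y * p x)"
        by (simp add: pos_le_divide_eq pos_divide_le_eq)
    qed
  qed
qed

text \<open>The factors \<open>h y\<close> cancel: for large \<open>x\<close>,
  \<open>k y (v * x) \<le> (1 + \<epsilon>) h y p (v x) \<le> (1 + \<epsilon>) \<rho> h y p x \<le> (1 + \<epsilon>) \<rho> / (1 - \<epsilon>) k y x\<close>,
  where \<open>\<rho> < 1\<close> bounds \<open>p (v x) / p x\<close>.  What remains is to take \<open>\<epsilon>\<close> so small that the last
  constant is still below \<open>1\<close>.\<close>

lemma uniform_tail_decrease:
  fixes k :: "'b \<Rightarrow> real \<Rightarrow> real" and p :: "real \<Rightarrow> real"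
  assumes unif: "((\<lambda>x. SUP y\<in>S. ereal \<bar>k y x / (h y * p x) - 1\<bar>) \<longlongrightarrow> 0) at_top"
    and h: "\<And>y. y \<in> S \<Longrightarrow> h y > 0"
    and p: "\<And>x. x \<ge> 0 \<Longrightarrow> p x > 0"
    and "v > 1"
    and decr: "Limsup at_top (\<lambda>x. ereal (p (v * x) / p x)) < 1"
  obtains q where "0 < q" "q < 1" "\<forall>\<^sub>F x in at_top. \<forall>y\<in>S. k y (v * x) \<le> q * k y x"
proof -
  obtain \<rho> where \<rho>: "0 < \<rho>" "\<rho> < 1" and ev_\<rho>: "\<forall>\<^sub>F x in at_top. p (v * x) / p x < \<rho>"
    using Limsup_less_1_bound[OF decr] by blast
  \<comment> \<open>With this choice \<open>(1 + \<epsilon>) \<rho> \<le> \<rho> + \<epsilon> = 1 - 3 \<epsilon> < 1 - \<epsilon>\<close>.\<close>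
  define \<epsilon> where "\<epsilon> = (1 - \<rho>) / 4"
  define q where "q = (1 + \<epsilon>) * \<rho> / (1 - \<epsilon>)"
  have \<epsilon>: "0 < \<epsilon>" "\<epsilon> < 1" using \<rho> by (auto simp: \<epsilon>_def)
  have "\<epsilon> * \<rho> \<le> \<epsilon>" using \<epsilon> \<rho> by (simp add: mult_left_le)
  moreover have "\<rho> = 1 - 4 * \<epsilon>" by (simp add: \<epsilon>_def field_simps)
  ultimately have "\<rho> + \<epsilon> * \<rho> < 1 - \<epsilon>" using \<epsilon> by linarith
  then have "(1 + \<epsilon>) * \<rho> < 1 - \<epsilon>" by (simp add: distrib_right)
  then have q: "0 < q" "q < 1" using \<epsilon> \<rho> by (auto simp: q_def)
  have bounds: "\<forall>\<^sub>F x in at_top. \<forall>y\<in>S. (1 - \<epsilon>) * (h y * p x) \<le> k y x \<and> k y x \<le> (1 + \<epsilon>) * (h y * p x)"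
    using unif h p \<epsilon>(1) by (rule uniform_equiv_bounds)
  have "filterlim (\<lambda>x. v * x) at_top at_top"
    using \<open>v > 1\<close> by (intro filterlim_tendsto_pos_mult_at_top[OF tendsto_const]) (auto simp: filterlim_ident)
  from eventually_compose_filterlim[OF bounds this]
  have "\<forall>\<^sub>F x in at_top. \<forall>y\<in>S. k y (v * x) \<le> (1 + \<epsilon>) * (h y * p (v * x))"
    by (rule eventually_mono) auto
  with bounds ev_\<rho> eventually_ge_at_top[of 0]
  have "\<forall>\<^sub>F x in at_top. \<forall>y\<in>S. k y (v * x) \<le> q * k y x"
  proof eventually_elim
    case (elim x)
    show ?case
    proof
      fix y assume y: "y \<in> S"
      have "p (v * x) \<le> \<rho> * p x"
        using elim(2) p[OF elim(3)] by (simp add: pos_divide_less_eq)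
      have "k y (v * x) \<le> (1 + \<epsilon>) * (h y * p (v * x))" using elim y by blast
      also have "\<dots> \<le> (1 + \<epsilon>) * (h y * (\<rho> * p x))"
        using \<open>p (v * x) \<le> \<rho> * p x\<close> h[OF y] \<epsilon> by (intro mult_left_mono) auto
      also have "\<dots> = q * ((1 - \<epsilon>) * (h y * p x))" using \<epsilon> by (simp add: q_def)
      also have "\<dots> \<le> q * k y x" using elim(1) y q by (intro mult_left_mono) auto
      finally show "k y (v * x) \<le> q * k y x" .
    qed
  qed
  with q that show thesis by blast
qed

section \<open>Positive decrease of the tail of the product\<close>

theorem theorem2p2:
  fixes M :: "'a measure" and X Y :: "'a \<Rightarrow> real" and K :: "real \<Rightarrow> real measure"
    and F G H :: "real \<Rightarrow> real"
  assumes "prob_space M"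
    and "X \<in> borel_measurable M" and "Y \<in> borel_measurable M"
    and F: "F = cdf (distr M borel X)"
    and G: "G = cdf (distr M borel Y)"
    and H: "H = cdf (distr M borel (\<lambda>\<omega>. X \<omega> * Y \<omega>))"
    and "measure_support (distr M borel X) = UNIV"
    and "(G \<longlongrightarrow> 0) (at_left 0)" and "G 0 < 1"
    and K: "regular_cond_distribution M X Y K"
    and A: "\<And>c. c > 0 \<Longrightarrow> (\<lambda>x. tail G (c * x)) \<in> o[at_top](\<lambda>x. tail H x)"
    and B: "\<exists>h :: real \<Rightarrow> real. (\<forall>y\<ge>0. h y > 0) \<and>
      ((\<lambda>x. SUP y\<in>measure_support (distr M borel Y).
          ereal \<bar>measure (K y) {x<..} / (h y * \<P>(\<omega> in M. X \<omega> > x)) - 1\<bar>) \<longlongrightarrow> 0) at_top"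
    and "F \<in> PD"
  shows "H \<in> PD"
proof -
  interpret prob_space M by fact
  note [measurable] = assms(2,3)
  define \<nu> where "\<nu> = distr M borel Y"
  define S where "S = measure_support \<nu>"
  interpret \<nu>: real_distribution \<nu> unfolding \<nu>_def by simp
  have tail_F: "tail F x = \<P>(\<omega> in M. X \<omega> > x)" for x
    unfolding F tail_cdf[OF real_distribution_distr[OF assms(2)]]
    by (simp add: measure_distr vimage_def Int_def conj_commute)
  have tail_G: "tail G x = measure \<nu> {x<..}" for x
    unfolding G \<nu>_def by (rule tail_cdf) simp

  note K_meas = regular_cond_distribution_kernel(1)[OF K]
    and K_prob = regular_cond_distribution_kernel(2)[OF K]
    and sets_K = regular_cond_distribution_kernel(3)[OF K]
  have K_mono: "measure (K y) {b<..} \<le> measure (K y) {a<..}" if "a \<le> b" for y a b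
    using that prob_space.finite_measure[OF K_prob]
    by (intro finite_measure.finite_measure_mono) (auto simp: sets_K)
  define \<phi> where "\<phi> x y = emeasure (K y) {s. s * y > x}" for x y
  have \<phi>_pos: "\<phi> x y = ennreal (measure (K y) {x / y<..})" if "y > 0" for x y
  proof -
    interpret Ky: prob_space "K y" by (rule K_prob)
    have "{s. s * y > x} = {x / y<..}" using that by (auto simp: field_simps)
    then show ?thesis by (simp add: \<phi>_def Ky.emeasure_eq_measure)
  qed
  have \<phi>_0: "\<phi> x 0 = 0" if "x \<ge> 0" for x
    using that by (simp add: \<phi>_def)
  have [measurable]: "\<phi> x \<in> borel_measurable borel" for x
  proof -
    have "{p :: real \<times> real. x < snd p * fst p} \<in> sets (borel \<Otimes>\<^sub>M borel)"
      unfolding borel_prod by (intro borel_open open_Collect_less continuous_intros)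
    moreover have "(SIGMA y:space borel. {s. x < s * y}) = {p :: real \<times> real. x < snd p * fst p}"
      by auto
    ultimately show ?thesis
      unfolding \<phi>_def using measurable_prob_algebraD[OF K_meas]
      by (intro emeasure_measurable_subprob_algebra2) auto
  qed
  have tail_H: "ennreal (tail H x) = (\<integral>\<^sup>+ y. \<phi> x y \<partial>\<nu>)" for x
  proof -
    have "tail H x = measure M {\<omega> \<in> space M. x < X \<omega> * Y \<omega>}"
      unfolding H by (subst tail_cdf[OF real_distribution_distr])
        (simp_all add: measure_distr vimage_def Int_def conj_commute)
    then show ?thesis
      using emeasure_product_gt[OF assms(1-3) K, of x]
      by (simp add: emeasure_eq_measure \<phi>_def \<nu>_def)
  qed

  have "measure \<nu> {..<0} = 0"
    using \<nu>.cdf_at_left[of 0] assms(8) unfolding G \<nu>_def[symmetric]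
    by (intro tendsto_unique) auto
  then have neg_null: "emeasure \<nu> {..<0} = 0"
    by (simp add: \<nu>.emeasure_eq_measure)
  have S_nonneg: "y \<ge> 0" if "y \<in> S" for y
  proof (rule ccontr)
    assume "\<not> y \<ge> 0"
    then have "emeasure \<nu> {..<0} > 0"
      using that by (auto simp: S_def measure_support_def)
    with neg_null show False by simp
  qed
  have AE_S: "AE y in \<nu>. y \<in> S"
    unfolding S_def by (rule AE_measure_support) simp

  obtain h where h: "\<And>y. y \<ge> 0 \<Longrightarrow> h y > 0"
    and unif: "((\<lambda>x. SUP y\<in>S. ereal \<bar>measure (K y) {x<..} / (h y * tail F x) - 1\<bar>) \<longlongrightarrow> 0) at_top"
    using B unfolding S_def \<nu>_def tail_F by blast
  have F_pos: "\<And>x. x \<ge> 0 \<Longrightarrow> tail F x > 0"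
    and F_decr: "\<And>v. v > 1 \<Longrightarrow> Limsup at_top (\<lambda>x. ereal (tail F (v * x) / tail F x)) < 1"
    using \<open>F \<in> PD\<close> by (auto simp: PD_def)

  \<comment> \<open>Uniform equivalence gives positivity far out; monotonicity carries it to every level.\<close>
  have K_pos: "measure (K y) {t<..} > 0" if y: "y \<in> S" for y t
  proof -
    have "\<forall>\<^sub>F x in at_top. \<forall>y\<in>S. (1 - 1/2) * (h y * tail F x) \<le> measure (K y) {x<..} \<and>
        measure (K y) {x<..} \<le> (1 + 1/2) * (h y * tail F x)"
      using S_nonneg h F_pos by (intro uniform_equiv_bounds[OF unif]) auto
    then have "\<forall>\<^sub>F x in at_top. x \<ge> t \<and> x \<ge> 0 \<and> (1 - 1/2) * (h y * tail F x) \<le> measure (K y) {x<..}"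
      using eventually_ge_at_top[of t] eventually_ge_at_top[of 0]
      by eventually_elim (use y in auto)
    then obtain x where x: "x \<ge> t" "x \<ge> 0" "(1 - 1/2) * (h y * tail F x) \<le> measure (K y) {x<..}"
      using eventually_happens'[OF trivial_limit_at_top_linorder] by blast
    have "0 < (1 - 1/2) * (h y * tail F x)" using h[OF S_nonneg[OF y]] F_pos[OF x(2)] by simp
    with x(3) K_mono[OF x(1), of y] show ?thesis by linarith
  qed

  \<comment> \<open>Otherwise the integrand, which is positive at every positive \<open>y\<close> in the support, would vanish
    almost everywhere, and \<open>Y\<close> would be concentrated at \<open>0\<close>.\<close>
  have H_pos: "tail H x > 0" if "x \<ge> 0" for x
  proof (rule ccontr)
    assume "\<not> tail H x > 0"
    then have "(\<integral>\<^sup>+ y. \<phi> x y \<partial>\<nu>) = 0" by (simp add: tail_H[symmetric] ennreal_neg)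
    then have "AE y in \<nu>. \<phi> x y = 0" by (simp add: nn_integral_0_iff_AE)
    with AE_S have "AE y in \<nu>. y \<in> {..0}"
    proof eventually_elim
      case (elim y)
      show ?case
      proof (rule ccontr)
        assume "y \<notin> {..0}"
        then show False using elim K_pos[of y "x / y"] \<phi>_pos[of y x] by simp
      qed
    qed
    then have "measure \<nu> {..0} = 1" by (subst \<nu>.prob_eq_1) auto
    then show False using \<open>G 0 < 1\<close> by (simp add: G \<nu>_def[symmetric] cdf_def)
  qed

  have H_decr: "Limsup at_top (\<lambda>x. ereal (tail H (v * x) / tail H x)) < 1" if v: "v > 1" for v
  proof -
    obtain q where q: "0 < q" "q < 1"
      and "\<forall>\<^sub>F t in at_top. \<forall>y\<in>S. measure (K y) {v * t<..} \<le> q * measure (K y) {t<..}"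
      using uniform_tail_decrease[OF unif _ F_pos v F_decr[OF v]] h S_nonneg by blast
    then have "\<forall>\<^sub>F t in at_top. t > 0 \<and> (\<forall>t'\<ge>t. \<forall>y\<in>S. measure (K y) {v * t'<..} \<le> q * measure (K y) {t'<..})"
      using eventually_gt_at_top[of 0] by (intro eventually_conj eventually_all_ge_at_top)
    then obtain T where T: "T > 0"
      and K_decr: "\<And>t y. t \<ge> T \<Longrightarrow> y \<in> S \<Longrightarrow> measure (K y) {v * t<..} \<le> q * measure (K y) {t<..}"
      using eventually_happens'[OF trivial_limit_at_top_linorder] by blast
    \<comment> \<open>For \<open>0 < y \<le> x / T\<close> the level \<open>x / y\<close> is at least \<open>T\<close>; for larger \<open>y\<close> the conditional
      probability is bounded by \<open>1\<close>.\<close>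
    have split: "tail H (v * x) \<le> q * tail H x + tail G (1 / T * x)" if x: "x \<ge> 0" for x
    proof -
      have "AE y in \<nu>. \<phi> (v * x) y \<le> ennreal q * \<phi> x y + indicator {x / T<..} y"
        using AE_S
      proof eventually_elim
        case (elim y)
        consider "y = 0" | "0 < y" "y \<le> x / T" | "y > x / T"
          using S_nonneg[OF elim] by fastforce
        then show ?case
        proof cases
          case 1
          then show ?thesis using x v by (simp add: \<phi>_0)
        next
          case 2
          then have "T \<le> x / y" using T by (simp add: field_simps)
          from K_decr[OF this elim]
          have "\<phi> (v * x) y \<le> ennreal q * \<phi> x y"
            using 2 q by (simp add: \<phi>_pos ennreal_mult'[symmetric] ennreal_leI)
          then show ?thesis by (rule order_trans) simp
        next
          case 3
          have "\<phi> (v * x) y \<le> 1"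
            unfolding \<phi>_def by (rule prob_space.emeasure_le_1[OF K_prob])
          then show ?thesis using 3 by (simp add: add_increasing)
        qed
      qed
      then have "(\<integral>\<^sup>+ y. \<phi> (v * x) y \<partial>\<nu>) \<le> (\<integral>\<^sup>+ y. ennreal q * \<phi> x y + indicator {x / T<..} y \<partial>\<nu>)"
        by (rule nn_integral_mono_AE)
      also have "\<dots> = ennreal q * (\<integral>\<^sup>+ y. \<phi> x y \<partial>\<nu>) + emeasure \<nu> {x / T<..}"
        by (subst nn_integral_add) (auto simp: nn_integral_cmult)
      finally have "ennreal (tail H (v * x)) \<le> ennreal q * ennreal (tail H x) + ennreal (tail G (1 / T * x))"
        by (simp add: tail_H tail_G \<nu>.emeasure_eq_measure)
      also have "\<dots> = ennreal (q * tail H x + tail G (1 / T * x))"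
        using q H_pos[OF x] by (simp add: ennreal_mult ennreal_plus tail_G)
      finally show ?thesis
        using q H_pos[OF x] by (subst (asm) ennreal_le_iff) (auto simp: tail_G)
    qed
    define \<delta> where "\<delta> = (1 - q) / 2"
    have \<delta>: "\<delta> > 0" "q + \<delta> < 1" using q by (auto simp: \<delta>_def field_simps)
    have "\<forall>\<^sub>F x in at_top. norm (tail G (1 / T * x)) \<le> \<delta> * norm (tail H x)"
      using A[of "1 / T"] T \<delta>(1) by (intro landau_o.smallD) auto
    then have "\<forall>\<^sub>F x in at_top. ereal (tail H (v * x) / tail H x) \<le> ereal (q + \<delta>)"
      using eventually_ge_at_top[of 0]
    proof eventually_elim
      case (elim x)
      then have "tail H (v * x) \<le> (q + \<delta>) * tail H x"
        using split[OF elim(2)] H_pos[OF elim(2)] by (simp add: algebra_simps)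
      then show ?case using H_pos[OF elim(2)] by (simp add: pos_divide_le_eq)
    qed
    then have "Limsup at_top (\<lambda>x. ereal (tail H (v * x) / tail H x)) \<le> ereal (q + \<delta>)"
      by (rule Limsup_bounded)
    also have "\<dots> < 1" using \<delta> by simp
    finally show ?thesis .
  qed
  have "\<exists>N. real_distribution N \<and> H = cdf N"
    unfolding H by (intro exI[of _ "distr M borel (\<lambda>\<omega>. X \<omega> * Y \<omega>)"]) simp
  then show ?thesis
    using H_pos H_decr by (auto simp: PD_def)
qed

end
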